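(* If $N$ is an odd perfect number with $r$ distinct prime factors, then $$N > \frac{1}{\left(2^{1/r}-1\right)^r}.$$
   Context: A positive integer $N$ is perfect if the sum of its proper divisors (positive divisors less than $N$) equals $N$; equivalently $\sigma(N)=2N$, where $\sigma(N)=\sum_{d\mid N} d$ is the sum of all positive divisors of $N$. *)

theory Defs
  imports Complex_Main "HOL-Computational_Algebra.Primes"
begin

definition perfect :: "nat \<Rightarrow> bool" where
  "perfect N \<longleftrightarrow> N > 0 \<and> \<Sum>{d. d dvd N \<and> d < N} = N"

end

theory Submission
  imports Defs "HOL-Analysis.Convex"
begin

text \<open>
  Let \<open>R\<close> be the product of the prime factors \<open>p\<close> of \<open>N\<close>. Expanding the product of the
  factors \<open>1 + 1/p\<close> gives the sum of \<open>1/d\<close> over the divisors \<open>d\<close> of \<open>R\<close>, hence a part of the sum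
  of \<open>1/d\<close> over the divisors of \<open>N\<close>. The latter is \<open>\<sigma>(N)/N = 2\<close>, so the product is at most \<open>2\<close>
  (\<open>prod_one_plus_inverse_le_sum_inverse_divisors\<close>).

  On the other hand, a product of \<open>r\<close> factors \<open>1 + x\<close> with prescribed product of the \<open>x\<close> is
  smallest when all \<open>x\<close> are equal (\<open>one_plus_geometric_mean_le\<close>). With \<open>x = 1/p\<close> this reads
  \<open>(1 + R powr (-1/r)) ^ r \<le> 2\<close>, which rearranges to \<open>R \<ge> 1 / (2 powr (1/r) - 1) ^ r\<close>, and
  \<open>N \<ge> R\<close>.

  The inequality is strict because the product of the \<open>1 + 1/p\<close> over odd primes is never
  exactly \<open>2\<close>: every \<open>p + 1\<close> contributes a factor \<open>2\<close>, but \<open>2 * R\<close> has just one, so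
  there would be at most one prime, which is absurd (\<open>prod_Suc_odd_primes_neq\<close>).
\<close>

lemma primes_dvd_prod_iff:
  fixes S :: "nat set"
  assumes "finite S" "\<And>p. p \<in> S \<Longrightarrow> prime p" "prime q"
  shows "q dvd \<Prod>S \<longleftrightarrow> q \<in> S"
proof -
  have "q dvd \<Prod>S \<longleftrightarrow> (\<exists>p\<in>S. q dvd p)"
    using prime_dvd_prod_iff[OF assms(1,3), of "\<lambda>p. p"] by simp
  also have "\<dots> \<longleftrightarrow> q \<in> S"
  proof
    assume "\<exists>p\<in>S. q dvd p"
    then obtain p where "p \<in> S" "q dvd p" by blast
    then show "q \<in> S"
      using primes_dvd_imp_eq[OF assms(3) assms(2)] by blast
  qed (use dvd_refl in blast)
  finally show ?thesis .
qed

text \<open>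
  A finite set of primes is recovered from its product as the set of primes dividing it.
\<close>

lemma inj_on_prod_primes:
  fixes P :: "nat set"
  assumes "finite P" "\<And>p. p \<in> P \<Longrightarrow> prime p"
  shows "inj_on (\<lambda>S. \<Prod>S) (Pow P)"
proof (rule inj_onI)
  fix S T assume ST: "S \<in> Pow P" "T \<in> Pow P" and eq: "\<Prod>S = \<Prod>T"
  have S: "finite S" "\<And>p. p \<in> S \<Longrightarrow> prime p" and T: "finite T" "\<And>p. p \<in> T \<Longrightarrow> prime p"
    using ST assms finite_subset by auto
  show "S = T"
  proof (rule set_eqI)
    fix q
    show "q \<in> S \<longleftrightarrow> q \<in> T"
    proof (cases "prime q")
      case True
      then show ?thesis
        using primes_dvd_prod_iff[OF S] primes_dvd_prod_iff[OF T] eq by simp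
    next
      case False
      then show ?thesis
        using S(2) T(2) by blast
    qed
  qed
qed

lemma prod_prime_factors_dvd:
  fixes N :: nat
  assumes "N > 0" "S \<subseteq> prime_factors N"
  shows "\<Prod>S dvd N"
proof -
  have "(\<Prod>p\<in>prime_factors N. p) dvd (\<Prod>p\<in>prime_factors N. p ^ multiplicity p N)"
    by (intro prod_dvd_prod dvd_power) (auto simp: prime_factors_multiplicity)
  also have "\<dots> = N"
    using assms(1) by (simp add: prod_prime_factors)
  finally show ?thesis
    using prod_dvd_prod_subset[OF finite_set_mset assms(2), of "\<lambda>p. p"] dvd_trans by blast
qed

text \<open>
  The involution \<open>d \<mapsto> N div d\<close> of the divisors turns the sum of reciprocals into \<open>\<sigma>(N)/N\<close>.
\<close>

lemma sum_inverse_divisors_perfect: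
  assumes "perfect N"
  shows "(\<Sum>d | d dvd N. 1 / real d) = 2"
proof -
  have N: "N > 0" and proper: "\<Sum>{d. d dvd N \<and> d < N} = N"
    using assms by (auto simp: perfect_def)
  have "{d. d dvd N} = insert N {d. d dvd N \<and> d < N}"
    using N by (auto dest: dvd_imp_le)
  then have sigma: "\<Sum>{d. d dvd N} = 2 * N"
    using proper by simp
  have "(\<Sum>d | d dvd N. 1 / real d) = (\<Sum>d | d dvd N. real d / real N)"
    by (rule sum.reindex_bij_witness[of _ "\<lambda>d. N div d" "\<lambda>d. N div d"])
       (use N in \<open>auto simp: real_of_nat_div field_simps\<close>)
  also have "\<dots> = real (\<Sum>{d. d dvd N}) / real N"
    by (simp add: sum_divide_distrib)
  finally show ?thesis
    using sigma N by simp
qed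

text \<open>
  Expanding the product yields one term \<open>1/d\<close> for each product \<open>d\<close> of a set of prime factors;
  these \<open>d\<close> are pairwise distinct divisors of \<open>N\<close>.
\<close>

lemma prod_one_plus_inverse_le_sum_inverse_divisors:
  assumes "N > 0"
  shows "(\<Prod>p\<in>prime_factors N. 1 + 1 / real p) \<le> (\<Sum>d | d dvd N. 1 / real d)"
proof -
  let ?P = "prime_factors N"
  have "(\<Prod>p\<in>?P. 1 + 1 / real p) = (\<Prod>p\<in>?P. 1 / real p + 1)"
    by (simp add: add.commute)
  also have "\<dots> = (\<Sum>S\<in>Pow ?P. \<Prod>p\<in>S. 1 / real p)"
    by (simp add: prod_add)
  also have "\<dots> = (\<Sum>S\<in>Pow ?P. 1 / real (\<Prod>S))"
    by (simp add: prod_dividef)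
  also have "\<dots> = (\<Sum>d\<in>(\<lambda>S. \<Prod>S) ` Pow ?P. 1 / real d)"
    by (subst sum.reindex) (auto intro!: inj_on_prod_primes)
  also have "\<dots> \<le> (\<Sum>d | d dvd N. 1 / real d)"
    using assms by (intro sum_mono2) (auto intro: prod_prime_factors_dvd)
  finally show ?thesis .
qed

text \<open>
  A comparison of powers of \<open>2\<close>: the left side is divisible by \<open>2 ^ card P\<close>, the right side is not
  divisible by \<open>4\<close>. That leaves the empty set and singletons, where \<open>1 = 2\<close> and
  \<open>p + 1 = 2 * p\<close> are impossible.
\<close>

lemma prod_Suc_odd_primes_neq:
  fixes P :: "nat set"
  assumes "finite P" "\<And>p. p \<in> P \<Longrightarrow> prime p \<and> odd p"
  shows "(\<Prod>p\<in>P. p + 1) \<noteq> 2 * \<Prod>P"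
proof
  assume eq: "(\<Prod>p\<in>P. p + 1) = 2 * \<Prod>P"
  have "(\<Prod>p\<in>P. 2) dvd (\<Prod>p\<in>P. p + 1)"
    using assms(2) by (intro prod_dvd_prod) auto
  then have dvd: "2 ^ card P dvd 2 * \<Prod>P"
    using eq by simp
  have "odd (\<Prod>P)"
    using assms(2) by (auto simp: even_prod_iff[OF assms(1)])
  then have "\<not> 2 ^ 2 dvd 2 * \<Prod>P"
    by (simp add: power2_eq_square)
  with dvd have "card P < 2"
    by (meson dvd_trans le_imp_power_dvd not_less)
  then consider "card P = 0" | "card P = 1" by linarith
  then show False
  proof cases
    case 1
    then show False using assms(1) eq by simp
  next
    case 2
    then obtain p where "P = {p}" by (auto simp: card_1_singleton_iff)
    then show False using eq assms(2)[of p] by (auto dest: prime_gt_1_nat)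
  qed
qed

text \<open>
  The inequality of Mahler (superadditivity of the geometric mean) for the vectors \<open>(1, ..., 1)\<close> and
  \<open>x\<close>. Dividing by the right side turns the two summands on the left into the geometric means of
  the numbers \<open>1 / (1 + x i)\<close> and \<open>x i / (1 + x i)\<close>. By the inequality of arithmetic and geometric
  means they are bounded by the corresponding arithmetic means, and these add up to \<open>1\<close>.
\<close>

lemma one_plus_geometric_mean_le:
  fixes x :: "'a \<Rightarrow> real"
  assumes "finite A" "A \<noteq> {}" "\<And>i. i \<in> A \<Longrightarrow> x i \<ge> 0"
  shows "1 + (\<Prod>i\<in>A. x i) powr (1 / card A) \<le> (\<Prod>i\<in>A. 1 + x i) powr (1 / card A)"
proof -
  let ?e = "1 / real (card A)"
  let ?Y = "(\<Prod>i\<in>A. 1 + x i) powr ?e"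
  have pos: "1 + x i > 0" if "i \<in> A" for i
    using assms(3)[OF that] by simp
  have card: "card A > 0"
    using assms by (simp add: card_gt_0_iff)
  have Ppos: "(\<Prod>i\<in>A. 1 + x i) > 0"
    using pos by (simp add: prod_pos)
  have "(\<Prod>i\<in>A. 1 / (1 + x i)) powr ?e \<le> (\<Sum>i\<in>A. 1 / (1 + x i) / card A)"
    using assms pos by (intro arith_geom_mean) (auto simp: less_imp_le)
  moreover have "(\<Prod>i\<in>A. x i / (1 + x i)) powr ?e \<le> (\<Sum>i\<in>A. x i / (1 + x i) / card A)"
    using assms pos by (intro arith_geom_mean) (auto simp: less_imp_le)
  moreover have "(\<Sum>i\<in>A. 1 / (1 + x i) / card A) + (\<Sum>i\<in>A. x i / (1 + x i) / card A) = 1"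
  proof -
    have "1 / (1 + x i) / card A + x i / (1 + x i) / card A = 1 / card A" if "i \<in> A" for i
      using pos[OF that] by (simp add: add_divide_distrib[symmetric])
    then show ?thesis
      using card by (simp add: sum.distrib[symmetric])
  qed
  ultimately have "(\<Prod>i\<in>A. 1 / (1 + x i)) powr ?e + (\<Prod>i\<in>A. x i / (1 + x i)) powr ?e \<le> 1"
    by linarith
  moreover have "(\<Prod>i\<in>A. 1 / (1 + x i)) powr ?e = 1 / ?Y"
    using Ppos by (simp add: prod_dividef powr_divide)
  moreover have "(\<Prod>i\<in>A. x i / (1 + x i)) powr ?e = (\<Prod>i\<in>A. x i) powr ?e / ?Y"
    using Ppos assms(3) by (simp add: prod_dividef powr_divide prod_nonneg)
  moreover have "?Y > 0"
    using Ppos by simp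
  ultimately show ?thesis
    by (simp add: add_divide_distrib[symmetric])
qed

theorem corollary1:
  fixes N r :: nat
  assumes "odd N"
    and "perfect N"
    and "r = card (prime_factors N)"
  shows "real N > 1 / (2 powr (1 / real r) - 1) ^ r"
proof -
  let ?P = "prime_factors N"
  let ?R = "\<Prod>?P"
  let ?c = "2 powr (1 / real r) - 1"
  have N: "N > 0"
    using assms(2) by (simp add: perfect_def)
  have odd_primes: "prime p \<and> odd p" if "p \<in> ?P" for p
    using that assms(1) by (auto dest: in_prime_factors_imp_dvd dvd_trans)
  have R: "?R > 0"
    by (auto intro!: prod_pos dest: in_prime_factors_imp_prime prime_gt_0_nat)
  have R_le: "?R \<le> N"
    using N prod_prime_factors_dvd[of N ?P] by (simp add: dvd_imp_le)
  \<comment> \<open>Without prime factors \<open>N\<close> would be \<open>1\<close>, whose single divisor contributes \<open>1\<close>, not \<open>2\<close>.\<close>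
  have "?P \<noteq> {}"
    using sum_inverse_divisors_perfect[OF assms(2)] N
    by (auto simp: prime_factorization_empty_iff)
  then have r: "r > 0"
    using assms(3) by (simp add: card_gt_0_iff)
  have prod_eq: "(\<Prod>p\<in>?P. 1 + 1 / real p) = real (\<Prod>p\<in>?P. p + 1) / real ?R"
  proof -
    have "(\<Prod>p\<in>?P. 1 + 1 / real p) = (\<Prod>p\<in>?P. real (p + 1) / real p)"
      by (intro prod.cong) (auto simp: field_simps dest: in_prime_factors_imp_prime)
    then show ?thesis by (simp add: prod_dividef)
  qed
  have "(\<Prod>p\<in>?P. 1 + 1 / real p) \<noteq> 2"
  proof
    assume "(\<Prod>p\<in>?P. 1 + 1 / real p) = 2"
    then have "real (\<Prod>p\<in>?P. p + 1) = real (2 * ?R)"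
      using prod_eq R by (simp add: field_simps)
    then show False
      using prod_Suc_odd_primes_neq[of ?P] odd_primes of_nat_eq_iff by blast
  qed
  then have less2: "(\<Prod>p\<in>?P. 1 + 1 / real p) < 2"
    using prod_one_plus_inverse_le_sum_inverse_divisors[OF N]
      sum_inverse_divisors_perfect[OF assms(2)] by simp
  have "1 + (1 / real ?R) powr (1 / real r) \<le> (\<Prod>p\<in>?P. 1 + 1 / real p) powr (1 / real r)"
    using one_plus_geometric_mean_le[of ?P "\<lambda>p. 1 / real p"] \<open>?P \<noteq> {}\<close> assms(3)
    by (simp add: prod_dividef)
  also have "\<dots> < 2 powr (1 / real r)"
    using less2 r by (intro powr_less_mono2) (auto intro!: prod_nonneg)
  finally have "(1 / real ?R) powr (1 / real r) < ?c"
    by simp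
  then have "((1 / real ?R) powr (1 / real r)) ^ r < ?c ^ r"
    using r by (intro power_strict_mono) auto
  moreover have "((1 / real ?R) powr (1 / real r)) ^ r = 1 / real ?R"
    using r R by (simp add: powr_power del: of_nat_prod)
  ultimately have lt: "1 / real ?R < ?c ^ r"
    by simp
  have "1 / ?c ^ r < real ?R"
  proof -
    have "0 < 1 / real ?R"
      using R by (simp del: of_nat_prod)
    then have "inverse (?c ^ r) < inverse (1 / real ?R)"
      using lt by (rule less_imp_inverse_less[rotated])
    then show ?thesis by (simp add: inverse_eq_divide)
  qed
  also have "\<dots> \<le> real N"
    using R_le by (simp del: of_nat_prod)
  finally show ?thesis .
qed

end
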